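(* Let $V_1,V_2$ be real orthogonal matrices of size $m\times m$, and for $\alpha=[\alpha_1,\alpha_2]$ with $\alpha_1,\alpha_2\in\mathbb{R}^m$ let $$N(\alpha)=V_1^T\,\mathrm{diag}(\alpha_1)\,V_1\,V_2^T\,\mathrm{diag}(\alpha_2)\,V_2 .$$ Assume that for $i\in\{1,2\}$ the entries of $\alpha_i$ are limited to the range $$\alpha_{i,j}\in[-\overline{n}_i,-\underline{n}_i]\cup[\underline{p}_i,\overline{p}_i]\quad\text{for all } j,$$ with $0\le\underline{n}_i\le\overline{n}_i$ and $0\le\underline{p}_i\le\overline{p}_i$, and define the constants $$\overline{n}=\max(\overline{p}_1\overline{n}_2,\overline{n}_1\overline{p}_2),\quad \overline{p}=\max(\overline{p}_1\overline{p}_2,\overline{n}_1\overline{n}_2),\quad \overline{r}=\sqrt{\overline{p}_1\overline{p}_2\overline{n}_1\overline{n}_2},$$ $$\underline{n}=\min(\underline{p}_1\underline{n}_2,\underline{n}_1\underline{p}_2),\quad \underline{p}=\min(\underline{p}_1\underline{p}_2,\underline{n}_1\underline{n}_2),\quad \underline{r}=\sqrt{\underline{p}_1\underline{p}_2\underline{n}_1\underline{n}_2},$$ which satisfy $0\le\underline{n}\le\underline{r}\le\overline{r}\le\overline{n}$ and $0\le\underline{p}\le\underline{r}\le\overline{r}\le\overline{p}$. Then the real-valued eigenvalues $\lambda$ of $N(\alpha)$ belong to the range $$\lambda\in[-\overline{n},-\underline{n}]\cup[\underline{p},\overline{p}],$$ while the complex-valued (i.e., non-real) eigenvalues $\lambda$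 of $N(\alpha)$ satisfy $$\underline{r}\le|\lambda|\le\overline{r}.$$
   Context: Here $\mathrm{diag}(v)$ is the diagonal matrix with the entries of the vector $v$ on its diagonal, and $\alpha_{i,j}$ is the $j$-th entry of $\alpha_i$. *)

theory Defs
  imports "Jordan_Normal_Form.Char_Poly"
begin

text \<open>
  The library predicate \<^const>\<open>orthogonal_mat\<close> only requires the columns to be pairwise
  orthogonal and non-isotropic; here \<open>A\<^sup>T A = A A\<^sup>T = I\<close> is meant.
\<close>

definition real_orthogonal_mat :: "nat \<Rightarrow> real mat \<Rightarrow> bool" where
  "real_orthogonal_mat m A \<longleftrightarrow>
     A \<in> carrier_mat m m \<and> A\<^sup>T * A = 1\<^sub>m m \<and> A * A\<^sup>T = 1\<^sub>m m"

definition diag_of_vec :: "real vec \<Rightarrow> real mat" where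
  "diag_of_vec v = mat_diag (dim_vec v) (\<lambda>j. v $ j)"

definition N_mat :: "real mat \<Rightarrow> real mat \<Rightarrow> real vec \<Rightarrow> real vec \<Rightarrow> real mat" where
  "N_mat V1 V2 \<alpha>1 \<alpha>2 = V1\<^sup>T * diag_of_vec \<alpha>1 * V1 * V2\<^sup>T * diag_of_vec \<alpha>2 * V2"

end

theory Submission
  imports Defs
begin

text \<open>
  Write \<open>N = A B\<close> with \<open>A = V1\<^sup>T diag(\<alpha>1) V1\<close> and \<open>B = V2\<^sup>T diag(\<alpha>2) V2\<close> real
  symmetric, and let \<open>A B x = \<lambda> x\<close> with \<open>x \<noteq> 0\<close>. Put \<open>y = B x\<close>, so that \<open>A y = \<lambda> x\<close>, and consider
  the real numbers \<open>X = \<parallel>x\<parallel>\<^sup>2\<close>, \<open>s = \<langle>B x, x\<rangle>\<close> and \<open>Y = \<parallel>y\<parallel>\<^sup>2\<close>. The corresponding triple for \<open>A\<close>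
  and \<open>y\<close> is \<open>\<parallel>y\<parallel>\<^sup>2 = Y\<close>, \<open>\<langle>A y, y\<rangle> = \<lambda> s\<close> and \<open>\<parallel>A y\<parallel>\<^sup>2 = \<bar>\<lambda>\<bar>\<^sup>2 X\<close>: it is expressed by the same
  three numbers.

  In the coordinates that diagonalise the symmetric matrix such a triple consists of the moments
  of order 0, 1 and 2 of a nonnegative measure carried by the diagonal entries \<open>d\<close>
  (\<open>symmetric_form_moments\<close>). Integrating polynomials with a constant sign on the allowed range,
  such as \<open>(d - p)(d + n)\<close>, yields linear inequalities between the moments (\<open>moment_bounds\<close>).
  The inequalities for \<open>A\<close> and \<open>B\<close> are then combined.

  The number \<open>\<langle>A y, y\<rangle> = \<lambda> s\<close> is real, so \<open>s = 0\<close> if \<open>\<lambda>\<close> is not real. The inequalities then only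
  relate \<open>X\<close> and \<open>Y\<close>, and eliminating \<open>Y\<close> bounds \<open>\<bar>\<lambda>\<bar>\<^sup>2\<close> by products of the four end points:
  this is the annulus.

  If \<open>\<lambda>\<close> is real, eliminating \<open>Y\<close> (for the outer bounds) or \<open>X\<close> (for the inner bounds) leaves an
  inequality that is affine in \<open>s\<close>, where \<open>s\<close> is confined to an interval. At the end points of
  this interval the inequality factors, for instance as \<open>(\<lambda> - p1 p2)(\<lambda> + n1 p2) \<le> 0\<close>, and this is
  false at both end points for \<open>\<lambda>\<close> outside the claimed range (\<open>real_eigenvalue_outer\<close>,
  \<open>real_eigenvalue_inner\<close>).
\<close>

section \<open>Moments of a measure on two intervals\<close>

text \<open>
  Each inequality integrates a polynomial whose sign is constant on the range:
  \<open>(d - ph)(d + nh) \<le> 0\<close> and \<open>-nh \<le> d \<le> ph\<close> hold as the range lies in \<open>[-nh, ph]\<close>; the products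
  \<open>(d - pl)(d + nl)\<close>, \<open>(d - pl) d\<close> and \<open>(d + nl) d\<close> are nonnegative as the range avoids the gap
  \<open>(-nl, pl)\<close>: all factors are nonnegative on the right interval and nonpositive on the left one.
\<close>

lemma moment_bounds:
  fixes w d :: "'i \<Rightarrow> real" and J :: "'i set"
  assumes w: "\<And>j. j \<in> J \<Longrightarrow> 0 \<le> w j"
    and d: "\<And>j. j \<in> J \<Longrightarrow> d j \<in> {- nh .. - nl} \<union> {pl .. ph}"
    and n: "0 \<le> nl" "nl \<le> nh" and p: "0 \<le> pl" "pl \<le> ph"
  defines "M \<equiv> \<lambda>k. (\<Sum>j\<in>J. d j ^ k * w j)"
  shows "M 2 + (nh - ph) * M 1 \<le> ph * nh * M 0"
    and "- nh * M 0 \<le> M 1" and "M 1 \<le> ph * M 0"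
    and "pl * nl * M 0 \<le> M 2 + (nl - pl) * M 1"
    and "pl * M 1 \<le> M 2" and "- nl * M 1 \<le> M 2"
proof -
  have poly: "0 \<le> a * M 2 + b * M 1 + c * M 0"
    if "\<And>j. j \<in> J \<Longrightarrow> 0 \<le> a * d j ^ 2 + b * d j + c" for a b c
  proof -
    have "0 \<le> (\<Sum>j\<in>J. (a * d j ^ 2 + b * d j + c) * w j)"
      by (intro sum_nonneg mult_nonneg_nonneg that w)
    also have "\<dots> = a * M 2 + b * M 1 + c * M 0"
      unfolding M_def by (simp add: sum_distrib_left sum.distrib[symmetric] algebra_simps)
    finally show ?thesis .
  qed
  have "0 \<le> (-1) * d j ^ 2 + (ph - nh) * d j + ph * nh" if "j \<in> J" for j
  proof -
    have "0 \<le> (ph - d j) * (d j + nh)" using d[OF that] n p by auto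
    then show ?thesis by (simp add: algebra_simps power2_eq_square)
  qed
  from poly[OF this] show "M 2 + (nh - ph) * M 1 \<le> ph * nh * M 0" by (simp add: algebra_simps)
  have "0 \<le> 0 * d j ^ 2 + 1 * d j + nh" if "j \<in> J" for j using d[OF that] n p by auto
  from poly[OF this] show "- nh * M 0 \<le> M 1" by simp
  have "0 \<le> 0 * d j ^ 2 + (-1) * d j + ph" if "j \<in> J" for j using d[OF that] n p by auto
  from poly[OF this] show "M 1 \<le> ph * M 0" by simp
  have "0 \<le> 1 * d j ^ 2 + (nl - pl) * d j + (- (pl * nl))" if "j \<in> J" for j
  proof -
    have "0 \<le> (d j - pl) * (d j + nl)"
      using d[OF that] n p by (auto intro: mult_nonneg_nonneg mult_nonpos_nonpos)
    then show ?thesis by (simp add: algebra_simps power2_eq_square)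
  qed
  from poly[OF this] show "pl * nl * M 0 \<le> M 2 + (nl - pl) * M 1" by simp
  have "0 \<le> 1 * d j ^ 2 + (- pl) * d j + 0" if "j \<in> J" for j
  proof -
    have "0 \<le> (d j - pl) * d j"
      using d[OF that] n p by (auto intro: mult_nonneg_nonneg mult_nonpos_nonpos)
    then show ?thesis by (simp add: algebra_simps power2_eq_square)
  qed
  from poly[OF this] show "pl * M 1 \<le> M 2" by simp
  have "0 \<le> 1 * d j ^ 2 + nl * d j + 0" if "j \<in> J" for j
  proof -
    have "0 \<le> (d j + nl) * d j"
      using d[OF that] n p by (auto intro: mult_nonneg_nonneg mult_nonpos_nonpos)
    then show ?thesis by (simp add: algebra_simps power2_eq_square)
  qed
  from poly[OF this] show "- nl * M 1 \<le> M 2" by simp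
qed

section \<open>Moments of a symmetric matrix at a complex vector\<close>

abbreviation cmat :: "real mat \<Rightarrow> complex mat" where
  "cmat \<equiv> map_mat complex_of_real"

lemma conjugate_cmat_mult_vec:
  assumes A: "A \<in> carrier_mat k m" and x: "x \<in> carrier_vec m"
  shows "conjugate (cmat A *\<^sub>v x) = cmat A *\<^sub>v conjugate x"
proof (rule eq_vecI)
  fix i assume "i < dim_vec (cmat A *\<^sub>v conjugate x)"
  then show "conjugate (cmat A *\<^sub>v x) $ i = (cmat A *\<^sub>v conjugate x) $ i"
    using A x by (auto simp: scalar_prod_def conjugate_complex_def)
qed (use A in auto)

lemma real_orthogonal_preserves_cscalar_prod:
  assumes V: "real_orthogonal_mat m V"
    and x: "x \<in> carrier_vec m" and y: "y \<in> carrier_vec m"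
  shows "(cmat V *\<^sub>v x) \<bullet>c (cmat V *\<^sub>v y) = x \<bullet>c y"
proof -
  have Vc: "cmat V \<in> carrier_mat m m" and VT: "(cmat V)\<^sup>T * cmat V = 1\<^sub>m m"
    using V by (auto simp: real_orthogonal_mat_def map_mat_transpose
        of_real_hom.mat_hom_mult[symmetric] of_real_hom.mat_hom_one)
  have "(cmat V *\<^sub>v x) \<bullet>c (cmat V *\<^sub>v y) = (cmat V *\<^sub>v x) \<bullet> (cmat V *\<^sub>v conjugate y)"
    using V y by (simp add: conjugate_cmat_mult_vec[of V m m] real_orthogonal_mat_def)
  also have "\<dots> = ((cmat V)\<^sup>T *\<^sub>v (cmat V *\<^sub>v x)) \<bullet> conjugate y"
    using Vc x y by (intro transpose_vec_mult_scalar[symmetric]) auto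
  also have "(cmat V)\<^sup>T *\<^sub>v (cmat V *\<^sub>v x) = x"
    using Vc x VT by (subst assoc_mult_mat_vec[symmetric]) auto
  finally show ?thesis .
qed

text \<open>
  In the orthonormal coordinates \<open>u = V x\<close> the matrix acts as \<open>diag(a)\<close>, so the weights are
  \<open>\<bar>u\<^sub>j\<bar>\<^sup>2\<close>. The vector \<open>x\<close> is complex as it will come from an eigenvector of a
  non-symmetric matrix; the three moments are nevertheless real.
\<close>

lemma symmetric_form_moments:
  assumes V: "real_orthogonal_mat m V" and a: "a \<in> carrier_vec m"
    and x: "x \<in> carrier_vec m"
    and y: "y = cmat (V\<^sup>T * diag_of_vec a * V) *\<^sub>v x"
  obtains w :: "nat \<Rightarrow> real" where "\<And>j. 0 \<le> w j"
    and "x \<bullet>c x = of_real (\<Sum>j<m. (a $ j) ^ 0 * w j)"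
    and "y \<bullet>c x = of_real (\<Sum>j<m. (a $ j) ^ 1 * w j)"
    and "y \<bullet>c y = of_real (\<Sum>j<m. (a $ j) ^ 2 * w j)"
proof
  define u where "u = cmat V *\<^sub>v x"
  define v where "v = cmat V *\<^sub>v y"
  define w where "w j = (cmod (u $ j))\<^sup>2" for j
  have Vc: "V \<in> carrier_mat m m" and VVT: "V * V\<^sup>T = 1\<^sub>m m"
    using V by (auto simp: real_orthogonal_mat_def)
  have Dc: "diag_of_vec a \<in> carrier_mat m m" using a by (auto simp: diag_of_vec_def)
  have u: "u \<in> carrier_vec m" using Vc x by (auto simp: u_def intro!: mult_mat_vec_carrier[of _ m m])
  have yc: "y \<in> carrier_vec m" using Vc Dc x by (auto simp: y intro!: mult_mat_vec_carrier[of _ m m] mult_carrier_mat[of _ m m])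
  have "V * (V\<^sup>T * diag_of_vec a * V) = V * V\<^sup>T * (diag_of_vec a * V)"
    using Vc Dc by (simp add: assoc_mult_mat[of _ m m _ m _ m])
  also have "\<dots> = diag_of_vec a * V" using Vc Dc by (simp add: VVT)
  finally have VN: "V * (V\<^sup>T * diag_of_vec a * V) = diag_of_vec a * V" .
  have "v = cmat (V * (V\<^sup>T * diag_of_vec a * V)) *\<^sub>v x"
    unfolding v_def y using Vc Dc x
    by (subst of_real_hom.mat_hom_mult[of _ m m _ m]) (auto intro!: assoc_mult_mat_vec[symmetric])
  also have "\<dots> = cmat (diag_of_vec a) *\<^sub>v u"
    unfolding VN u_def using Vc Dc x
    by (subst of_real_hom.mat_hom_mult[of _ m m _ m]) (auto intro!: assoc_mult_mat_vec)
  finally have v: "v = cmat (diag_of_vec a) *\<^sub>v u" .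
  have vj: "v $ j = of_real (a $ j) * u $ j" if "j < m" for j
  proof -
    have "v $ j = (\<Sum>i\<in>{0..<m}. (if j = i then of_real (a $ i) else 0) * u $ i)"
      using a u that by (auto simp: v diag_of_vec_def mat_diag_def scalar_prod_def intro!: sum.cong)
    also have "\<dots> = (\<Sum>i\<in>{0..<m}. if j = i then of_real (a $ i) * u $ i else 0)"
      by (intro sum.cong) auto
    finally show ?thesis using that by simp
  qed
  have vc: "v \<in> carrier_vec m" using Vc yc by (auto simp: v_def intro!: mult_mat_vec_carrier[of _ m m])
  have w: "u $ j * cnj (u $ j) = of_real (w j)" for j
    unfolding w_def by (rule complex_norm_square[symmetric])
  show "0 \<le> w j" for j by (simp add: w_def)
  have "x \<bullet>c x = u \<bullet>c u" "y \<bullet>c x = v \<bullet>c u" "y \<bullet>c y = v \<bullet>c v"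
    unfolding u_def v_def using real_orthogonal_preserves_cscalar_prod[OF V] x yc by simp_all
  moreover have "u \<bullet>c u = of_real (\<Sum>j<m. (a $ j) ^ 0 * w j)"
    using u by (auto simp: scalar_prod_def conjugate_complex_def atLeast0LessThan w)
  moreover have "v \<bullet>c u = of_real (\<Sum>j<m. (a $ j) ^ 1 * w j)"
    using u vc by (auto simp: scalar_prod_def conjugate_complex_def atLeast0LessThan vj
        w[symmetric] mult.assoc intro!: sum.cong)
  moreover have "v \<bullet>c v = of_real (\<Sum>j<m. (a $ j) ^ 2 * w j)"
    using u vc by (auto simp: scalar_prod_def conjugate_complex_def atLeast0LessThan vj
        w[symmetric] power2_eq_square mult_ac intro!: sum.cong)
  ultimately show "x \<bullet>c x = of_real (\<Sum>j<m. (a $ j) ^ 0 * w j)"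
    "y \<bullet>c x = of_real (\<Sum>j<m. (a $ j) ^ 1 * w j)"
    "y \<bullet>c y = of_real (\<Sum>j<m. (a $ j) ^ 2 * w j)" by simp_all
qed

section \<open>Real eigenvalues\<close>

text \<open>
  Eliminating \<open>Y\<close> gives \<open>(\<lambda>\<^sup>2 - p1 n1 p2 n2) X \<le> s c\<close>. The right-hand side is affine in
  \<open>s \<in> [- n2 X, p2 X]\<close>, so it is enough to refute the inequality at the end point that the sign
  of \<open>c\<close> selects.
\<close>

lemma real_eigenvalue_outer:
  fixes X Y s lam p1 n1 p2 n2 :: real
  assumes X: "0 < X"
    and nonneg: "0 \<le> p1" "0 \<le> n1" "0 \<le> p2" "0 \<le> n2"
    and B: "Y + (n2 - p2) * s \<le> p2 * n2 * X" "- n2 * X \<le> s" "s \<le> p2 * X"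
    and A: "lam\<^sup>2 * X + (n1 - p1) * (lam * s) \<le> p1 * n1 * Y"
  shows "- max (p1 * n2) (n1 * p2) \<le> lam" and "lam \<le> max (p1 * p2) (n1 * n2)"
proof -
  define c where "c = p1 * n1 * (p2 - n2) + (p1 - n1) * lam"
  have "p1 * n1 * (Y + (n2 - p2) * s) \<le> p1 * n1 * (p2 * n2 * X)"
    using B(1) nonneg by (intro mult_left_mono) auto
  then have sc: "(lam\<^sup>2 - p1 * n1 * p2 * n2) * X \<le> s * c"
    using A by (simp add: c_def algebra_simps)
  have alt: "(lam - p1 * p2) * (lam + n1 * p2) \<le> 0 \<or> (lam - n1 * n2) * (lam + p1 * n2) \<le> 0"
  proof (cases "0 \<le> c")
    case True
    then have "s * c \<le> (p2 * X) * c" using B(3) by (rule_tac mult_right_mono)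
    then have "X * ((lam - p1 * p2) * (lam + n1 * p2)) \<le> 0"
      using sc by (simp add: c_def algebra_simps power2_eq_square)
    then show ?thesis using X by (simp add: mult_le_0_iff)
  next
    case False
    then have "s * c \<le> (- n2 * X) * c" using B(2) by (intro mult_right_mono_neg) auto
    then have "X * ((lam - n1 * n2) * (lam + p1 * n2)) \<le> 0"
      using sc by (simp add: c_def algebra_simps power2_eq_square)
    then show ?thesis using X by (simp add: mult_le_0_iff)
  qed
  have pr: "0 \<le> p1 * p2" "0 \<le> n1 * p2" "0 \<le> n1 * n2" "0 \<le> p1 * n2" using nonneg by auto
  show "- max (p1 * n2) (n1 * p2) \<le> lam"
    using alt pr by (auto simp: mult_le_0_iff)
  show "lam \<le> max (p1 * p2) (n1 * n2)"
    using alt pr by (auto simp: mult_le_0_iff)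
qed

text \<open>
  The bounds on \<open>s\<close> are now relative to \<open>Y\<close>, as they would be for \<open>B\<^sup>-\<^sup>1\<close> at \<open>y\<close>. This makes the
  statement the mirror image of \<open>real_eigenvalue_outer\<close> for the inverse matrix, without inverting
  anything: eliminate \<open>X\<close>, and note that the resulting inequality is affine in
  \<open>s \<in> [- Y / n2, Y / p2]\<close>.
\<close>

lemma real_eigenvalue_inner:
  fixes X Y s lam p1 n1 p2 n2 :: real
  assumes X: "0 < X"
    and pos: "0 < p1" "0 < n1" "0 < p2" "0 < n2"
    and B: "p2 * n2 * X \<le> Y + (n2 - p2) * s" "p2 * s \<le> Y" "- n2 * s \<le> Y"
    and A: "p1 * n1 * Y \<le> lam\<^sup>2 * X + (n1 - p1) * (lam * s)"
  shows "lam \<le> - min (p1 * n2) (n1 * p2) \<or> min (p1 * p2) (n1 * n2) \<le> lam"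
proof -
  have Y: "0 < Y"
  proof (rule ccontr)
    \<comment> \<open>Otherwise \<open>s = 0\<close>, and the first inequality for \<open>B\<close> makes \<open>X\<close> vanish.\<close>
    assume "\<not> 0 < Y"
    then have "p2 * s \<le> 0" "- n2 * s \<le> 0" using B by linarith+
    then have "s = 0" using pos by (simp add: mult_le_0_iff zero_le_mult_iff)
    moreover have "0 < p2 * n2 * X" using pos X by simp
    ultimately show False using B(1) \<open>\<not> 0 < Y\<close> by simp
  qed
  define c where "c = p2 * n2 * (n1 - p1) * lam + lam\<^sup>2 * (n2 - p2)"
  have "lam\<^sup>2 * (p2 * n2 * X) \<le> lam\<^sup>2 * (Y + (n2 - p2) * s)"
    using B(1) by (intro mult_left_mono) auto
  moreover have "(p2 * n2) * (p1 * n1 * Y) \<le> (p2 * n2) * (lam\<^sup>2 * X + (n1 - p1) * (lam * s))"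
    using A pos by (intro mult_left_mono) auto
  ultimately have sc: "(p1 * n1 * p2 * n2 - lam\<^sup>2) * Y \<le> s * c"
    by (simp add: c_def algebra_simps)
  have alt: "(p1 * p2 - lam) * (n1 * p2 + lam) \<le> 0 \<or> (n1 * n2 - lam) * (p1 * n2 + lam) \<le> 0"
  proof (cases "0 \<le> c")
    case True
    have "p2 * ((p1 * n1 * p2 * n2 - lam\<^sup>2) * Y) \<le> p2 * (s * c)"
      using sc pos by (intro mult_left_mono) auto
    also have "\<dots> \<le> Y * c" using mult_right_mono[OF B(2) True] by (simp add: mult_ac)
    finally have "(n2 * Y) * ((p1 * p2 - lam) * (n1 * p2 + lam)) \<le> 0"
      by (simp add: c_def algebra_simps power2_eq_square)
    then show ?thesis using mult_pos_pos[OF pos(4) Y] by (simp add: mult_le_0_iff[of "_ * Y"])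
  next
    case False
    have "n2 * ((p1 * n1 * p2 * n2 - lam\<^sup>2) * Y) \<le> n2 * (s * c)"
      using sc pos by (intro mult_left_mono) auto
    also have "\<dots> \<le> - Y * c" using mult_right_mono[OF B(3), of "- c"] False by (simp add: mult_ac)
    finally have "(p2 * Y) * ((n1 * n2 - lam) * (p1 * n2 + lam)) \<le> 0"
      by (simp add: c_def algebra_simps power2_eq_square)
    then show ?thesis using mult_pos_pos[OF pos(3) Y] by (simp add: mult_le_0_iff[of "_ * Y"])
  qed
  then show ?thesis by (auto simp: mult_le_0_iff)
qed

section \<open>Eigenvalues of the product\<close>

text \<open>
  For the order of the constants: as \<open>(p1 n2)(n1 p2) = (p1 p2)(n1 n2)\<close>, the radius \<open>r\<close> is the
  geometric mean both of the two products that compete for \<open>n\<close> and of those that compete for \<open>p\<close>.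
\<close>

lemma min_le_sqrt_mult_le_max:
  fixes a b :: real
  assumes "0 \<le> a" "0 \<le> b"
  shows "min a b \<le> sqrt (a * b)" and "sqrt (a * b) \<le> max a b"
proof -
  have "min a b * min a b \<le> a * b" "a * b \<le> max a b * max a b"
    using assms by (intro mult_mono; auto)+
  then show "min a b \<le> sqrt (a * b)" "sqrt (a * b) \<le> max a b"
    using assms by (auto intro!: real_le_rsqrt real_le_lsqrt simp: power2_eq_square)
qed

theorem theorem2:
  fixes m :: nat
    and V1 V2 :: "real mat"
    and \<alpha>1 \<alpha>2 :: "real vec"
    and n1_lo n1_hi p1_lo p1_hi n2_lo n2_hi p2_lo p2_hi :: real
    and n_lo n_hi p_lo p_hi r_lo r_hi :: real
  assumes V1: "real_orthogonal_mat m V1"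
    and V2: "real_orthogonal_mat m V2"
    and \<alpha>1: "\<alpha>1 \<in> carrier_vec m"
    and \<alpha>2: "\<alpha>2 \<in> carrier_vec m"
    and n1: "0 \<le> n1_lo" "n1_lo \<le> n1_hi"
    and p1: "0 \<le> p1_lo" "p1_lo \<le> p1_hi"
    and n2: "0 \<le> n2_lo" "n2_lo \<le> n2_hi"
    and p2: "0 \<le> p2_lo" "p2_lo \<le> p2_hi"
    and range1: "\<And>j. j < m \<Longrightarrow> \<alpha>1 $ j \<in> {- n1_hi .. - n1_lo} \<union> {p1_lo .. p1_hi}"
    and range2: "\<And>j. j < m \<Longrightarrow> \<alpha>2 $ j \<in> {- n2_hi .. - n2_lo} \<union> {p2_lo .. p2_hi}"
    and n_hi: "n_hi = max (p1_hi * n2_hi) (n1_hi * p2_hi)"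
    and p_hi: "p_hi = max (p1_hi * p2_hi) (n1_hi * n2_hi)"
    and r_hi: "r_hi = sqrt (p1_hi * p2_hi * n1_hi * n2_hi)"
    and n_lo: "n_lo = min (p1_lo * n2_lo) (n1_lo * p2_lo)"
    and p_lo: "p_lo = min (p1_lo * p2_lo) (n1_lo * n2_lo)"
    and r_lo: "r_lo = sqrt (p1_lo * p2_lo * n1_lo * n2_lo)"
  shows "(0 \<le> n_lo \<and> n_lo \<le> r_lo \<and> r_lo \<le> r_hi \<and> r_hi \<le> n_hi) \<and>
    (0 \<le> p_lo \<and> p_lo \<le> r_lo \<and> r_lo \<le> r_hi \<and> r_hi \<le> p_hi) \<and>
    (\<forall>lam::complex. eigenvalue (map_mat complex_of_real (N_mat V1 V2 \<alpha>1 \<alpha>2)) lam \<longrightarrow>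
       (lam \<in> \<real> \<longrightarrow> Re lam \<in> {- n_hi .. - n_lo} \<union> {p_lo .. p_hi}) \<and>
       (lam \<notin> \<real> \<longrightarrow> r_lo \<le> cmod lam \<and> cmod lam \<le> r_hi))"
proof (intro conjI)
  have lo_hi: "p1_lo * p2_lo * n1_lo * n2_lo \<le> p1_hi * p2_hi * n1_hi * n2_hi"
    using n1 p1 n2 p2 by (intro mult_mono mult_nonneg_nonneg) auto
  show "0 \<le> n_lo" "0 \<le> p_lo" using n1 p1 n2 p2 by (auto simp: n_lo p_lo)
  show "r_lo \<le> r_hi" "r_lo \<le> r_hi" using lo_hi by (simp_all add: r_lo r_hi)
  show "n_lo \<le> r_lo"
    using min_le_sqrt_mult_le_max(1)[of "p1_lo * n2_lo" "n1_lo * p2_lo"] n1 p1 n2 p2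
    by (simp add: n_lo r_lo mult_ac)
  show "p_lo \<le> r_lo"
    using min_le_sqrt_mult_le_max(1)[of "p1_lo * p2_lo" "n1_lo * n2_lo"] n1 p1 n2 p2
    by (simp add: p_lo r_lo mult_ac)
  show "r_hi \<le> n_hi"
    using min_le_sqrt_mult_le_max(2)[of "p1_hi * n2_hi" "n1_hi * p2_hi"] n1 p1 n2 p2
    by (simp add: n_hi r_hi mult_ac)
  show "r_hi \<le> p_hi"
    using min_le_sqrt_mult_le_max(2)[of "p1_hi * p2_hi" "n1_hi * n2_hi"] n1 p1 n2 p2
    by (simp add: p_hi r_hi mult_ac)
  show "\<forall>lam::complex. eigenvalue (cmat (N_mat V1 V2 \<alpha>1 \<alpha>2)) lam \<longrightarrow>
       (lam \<in> \<real> \<longrightarrow> Re lam \<in> {- n_hi .. - n_lo} \<union> {p_lo .. p_hi}) \<and>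
       (lam \<notin> \<real> \<longrightarrow> r_lo \<le> cmod lam \<and> cmod lam \<le> r_hi)"
  proof (rule allI, rule impI)
    fix lam :: complex
    assume ev: "eigenvalue (cmat (N_mat V1 V2 \<alpha>1 \<alpha>2)) lam"
    define A where "A = V1\<^sup>T * diag_of_vec \<alpha>1 * V1"
    define B where "B = V2\<^sup>T * diag_of_vec \<alpha>2 * V2"
    have Vc: "V1 \<in> carrier_mat m m" "V2 \<in> carrier_mat m m"
      using V1 V2 by (auto simp: real_orthogonal_mat_def)
    have Dc: "diag_of_vec \<alpha>1 \<in> carrier_mat m m" "diag_of_vec \<alpha>2 \<in> carrier_mat m m"
      using \<alpha>1 \<alpha>2 by (auto simp: diag_of_vec_def)
    have Ac: "A \<in> carrier_mat m m" and Bc: "B \<in> carrier_mat m m"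
      using Vc Dc by (auto simp: A_def B_def)
    have N: "N_mat V1 V2 \<alpha>1 \<alpha>2 = A * B"
      using Vc Dc by (simp add: N_mat_def A_def B_def assoc_mult_mat[of _ m m _ m _ m])
    obtain x where x: "x \<in> carrier_vec m" "x \<noteq> 0\<^sub>v m" and Nx: "cmat (A * B) *\<^sub>v x = lam \<cdot>\<^sub>v x"
      using ev Ac unfolding N eigenvalue_def eigenvector_def by auto
    define y where "y = cmat B *\<^sub>v x"
    have y: "y \<in> carrier_vec m" using Bc x by (auto simp: y_def intro!: mult_mat_vec_carrier[of _ m m])
    have Ay: "lam \<cdot>\<^sub>v x = cmat A *\<^sub>v y"
      unfolding Nx[symmetric] y_def using Ac Bc x
      by (subst of_real_hom.mat_hom_mult[of _ m m _ m]) (auto intro!: assoc_mult_mat_vec)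
    obtain w2 where w2: "\<And>j. 0 \<le> w2 j"
      "x \<bullet>c x = of_real (\<Sum>j<m. (\<alpha>2 $ j) ^ 0 * w2 j)"
      "y \<bullet>c x = of_real (\<Sum>j<m. (\<alpha>2 $ j) ^ 1 * w2 j)"
      "y \<bullet>c y = of_real (\<Sum>j<m. (\<alpha>2 $ j) ^ 2 * w2 j)"
      using symmetric_form_moments[OF V2 \<alpha>2 x(1) y_def[unfolded B_def]] by blast
    obtain w1 where w1: "\<And>j. 0 \<le> w1 j"
      "y \<bullet>c y = of_real (\<Sum>j<m. (\<alpha>1 $ j) ^ 0 * w1 j)"
      "(lam \<cdot>\<^sub>v x) \<bullet>c y = of_real (\<Sum>j<m. (\<alpha>1 $ j) ^ 1 * w1 j)"
      "(lam \<cdot>\<^sub>v x) \<bullet>c (lam \<cdot>\<^sub>v x) = of_real (\<Sum>j<m. (\<alpha>1 $ j) ^ 2 * w1 j)"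
      using symmetric_form_moments[OF V1 \<alpha>1 y Ay[unfolded A_def]] by blast
    define M1 where "M1 k = (\<Sum>j<m. (\<alpha>1 $ j) ^ k * w1 j)" for k
    define M2 where "M2 k = (\<Sum>j<m. (\<alpha>2 $ j) ^ k * w2 j)" for k
    define X s Y where "X = M2 0" and "s = M2 1" and "Y = M2 2"
    note form = w2(2-4)[folded M2_def, folded X_def s_def Y_def] w1(2-4)[folded M1_def]
    have "0 < x \<bullet>c x" using x by simp
    then have X: "0 < X" unfolding form(1) by (simp add: less_complex_def)
    have "x \<bullet>c y = conjugate (y \<bullet>c x)"
      using conjugate_conjugate_sprod[OF y x(1)] conjugate_vec_sprod_comm[OF x(1) y]
        conjugate_sprod_vec[of y m "conjugate x"] x(1) y by simp
    then have xy: "x \<bullet>c y = of_real s" by (simp add: form conjugate_complex_def)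
    have M1_0: "M1 0 = Y" using form(3,4) by simp
    have M1_1: "of_real (M1 1) = lam * of_real s"
      using form(5) x(1) y xy by simp
    have "of_real (M1 2) = lam * cnj lam * of_real X"
      using form(6) x(1) by (simp add: conjugate_smult_vec form(1) conjugate_complex_def mult_ac)
    also have "\<dots> = of_real ((cmod lam)\<^sup>2 * X)"
      by (simp only: of_real_mult complex_norm_square)
    finally have M1_2: "M1 2 = (cmod lam)\<^sup>2 * X" by (simp only: of_real_eq_iff)
    have b1: "M1 2 + (n1_hi - p1_hi) * M1 1 \<le> p1_hi * n1_hi * M1 0"
      "p1_lo * n1_lo * M1 0 \<le> M1 2 + (n1_lo - p1_lo) * M1 1"
      unfolding M1_def using w1(1) range1 n1 p1
      by (intro moment_bounds; simp)+
    have b2: "M2 2 + (n2_hi - p2_hi) * M2 1 \<le> p2_hi * n2_hi * M2 0"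
      "- n2_hi * M2 0 \<le> M2 1" "M2 1 \<le> p2_hi * M2 0"
      "p2_lo * n2_lo * M2 0 \<le> M2 2 + (n2_lo - p2_lo) * M2 1"
      "p2_lo * M2 1 \<le> M2 2" "- n2_lo * M2 1 \<le> M2 2"
      unfolding M2_def
      using moment_bounds[of "{..<m}" w2 "\<lambda>j. \<alpha>2 $ j", OF _ _ n2 p2] w2(1) range2 by auto
    note b2' = b2[folded X_def s_def Y_def]
    show "(lam \<in> \<real> \<longrightarrow> Re lam \<in> {- n_hi .. - n_lo} \<union> {p_lo .. p_hi}) \<and>
       (lam \<notin> \<real> \<longrightarrow> r_lo \<le> cmod lam \<and> cmod lam \<le> r_hi)"
    proof (intro conjI impI)
      assume "lam \<in> \<real>"
      then obtain l where l: "lam = of_real l" by (auto elim: Reals_cases)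
      have "of_real (M1 1) = complex_of_real (l * s)" using M1_1 by (simp add: l)
      then have M1_1': "M1 1 = l * s" by (simp only: of_real_eq_iff)
      have M1_2': "M1 2 = l\<^sup>2 * X" by (simp add: M1_2 l)
      note b1' = b1[unfolded M1_0 M1_1' M1_2']
      have outer: "- n_hi \<le> l" "l \<le> p_hi"
        unfolding n_hi p_hi
        using real_eigenvalue_outer[OF X _ _ _ _ b2'(1-3) b1'(1)] n1 p1 n2 p2 by auto
      have inner: "l \<le> - n_lo \<or> p_lo \<le> l"
      proof (cases "0 < p1_lo \<and> 0 < n1_lo \<and> 0 < p2_lo \<and> 0 < n2_lo")
        case True
        then show ?thesis
          unfolding n_lo p_lo using real_eigenvalue_inner[OF X _ _ _ _ b2'(4-6) b1'(2)] by auto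
      next
        \<comment> \<open>If one of the four end points is 0, both inner bounds are 0 and there is no gap.\<close>
        case False
        then have "n_lo = 0" "p_lo = 0" using n1 p1 n2 p2
          by (auto simp: n_lo p_lo min_def not_less mult_le_0_iff dest!: order_antisym)
        then show ?thesis by auto
      qed
      show "Re lam \<in> {- n_hi .. - n_lo} \<union> {p_lo .. p_hi}"
        using outer inner by (auto simp: l)
    next
      assume "lam \<notin> \<real>"
      then have "Im lam \<noteq> 0" by (simp add: complex_is_Real_iff)
      moreover have "Im lam * s = 0" using arg_cong[OF M1_1, of Im] by simp
      ultimately have s: "s = 0" by simp
      then have "M1 1 = 0" using M1_1 by simp
      note b = b1[unfolded M1_0 M1_2 this] b2'[unfolded s]
      have "(cmod lam)\<^sup>2 * X \<le> p1_hi * n1_hi * Y" using b(1) by simp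
      also have "\<dots> \<le> p1_hi * n1_hi * (p2_hi * n2_hi * X)"
        using b(3) n1 p1 by (intro mult_left_mono) auto
      finally have hi: "(cmod lam)\<^sup>2 \<le> p1_hi * p2_hi * n1_hi * n2_hi"
        using X by (simp add: mult_ac)
      have "p1_lo * n1_lo * (p2_lo * n2_lo * X) \<le> p1_lo * n1_lo * Y"
        using b(6) n1 p1 by (intro mult_left_mono) auto
      also have "\<dots> \<le> (cmod lam)\<^sup>2 * X" using b(2) by simp
      finally have lo: "p1_lo * p2_lo * n1_lo * n2_lo \<le> (cmod lam)\<^sup>2"
        using X by (simp add: mult_ac)
      show "cmod lam \<le> r_hi" unfolding r_hi using hi by (rule real_le_rsqrt)
      show "r_lo \<le> cmod lam" unfolding r_lo using lo by (intro real_le_lsqrt) auto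
    qed
  qed
qed

end
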